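(* Let $Q$ be a quiver of type $ADE$, let $\tilde{w}_0$ be a reduced expression of $w_0$ adapted to $Q$, and let $c$ be the Coxeter element associated to $Q$. Then for all $i\in I$, $$\mathcal{C}^i_{\tilde{w}_0}=\big(c^{N_i-1}(-\omega_{i^*}),\ c^{N_i-2}(-\omega_{i^*}),\ \ldots,\ c(-\omega_{i^*}),\ -\omega_{i^*}\big)$$ as ordered tuples, where $N_i=N_i(Q)$.
   Context: Let $D$ be a Dynkin diagram of type $ADE$ with vertex set $I=\{1,\dots,n\}$, $\Phi^+$ its positive roots, $N=|\Phi^+|$, $\alpha_i$ the simple roots, $\omega_i$ the fundamental weights, $W$ the Weyl group with simple reflections $s_i$, and $w_0$ its longest element. The involution $i\mapsto i^*$ of $I$ is defined by $w_0(\alpha_i)=-\alpha_{i^*}$. A quiver $Q$ of type $ADE$ is an orientation of the edges of such a $D$. A vertex $k$ is a sink of $Q$ if all arrows incident to $k$ enter $k$; then $S_kQ$ is obtained from $Q$ by reversing all arrows ending at $k$. A reduced expression $\tilde w_0=s_{i_1}\cdots s_{i_N}$ of $w_0$ is adapted to $Q$ if $i_1$ is a sink of $Q$, $i_2$ a sink of $S_{i_1}Q$, $i_3$ a sink of $S_{i_2}S_{i_1}Q$, and so on. For a reduced expression $\tilde w_0=s_{i_1}\cdots s_{i_N}$, put $\mu_k=s_{i_1}\cdots s_{i_k}(\omega_{i_k})$. The $i$-th level $\mathcal{C}^i_{\tilde w_0}$ is the tuple of the weights $\mu_k$ with $i_k=i$, ordered by increasing $k$. For $\tilde w_0$ adapted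 to $Q$, $N_i(Q)$ denotes its length, i.e. the number of $k$ with $i_k=i$ (it depends only on $Q$). Coxeter element associated to $Q$: number the vertices of $Q$ as $\beta_1,\dots,\beta_n$ in such a way that an arrow $\beta_j\to\beta_k$ in $Q$ implies $j>k$ (so $\beta_1$ is a sink of $Q$), and set $c=s_{\beta_n}\cdots s_{\beta_2}s_{\beta_1}\in W$; this element does not depend on the choice of such a numbering. *)

theory Defs
  imports "HOL-Analysis.Analysis"
begin

text \<open>
  A finite simple graph or quiver on the vertex type \<open>'v\<close> is a relation on \<open>'v\<close>: symmetric for a
  Dynkin diagram; for a quiver, \<open>(a, b)\<close> stands for an arrow from \<open>a\<close> to \<open>b\<close>.
\<close>

text \<open>Each edge of the following diagrams on \<open>{1..n}\<close> is listed once. The labels are Bourbaki's.\<close>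

definition A_edges :: "nat \<Rightarrow> (nat \<times> nat) set" where
  "A_edges n = {(i, i + 1) | i. 1 \<le> i \<and> i + 1 \<le> n}"

definition D_edges :: "nat \<Rightarrow> (nat \<times> nat) set" where
  "D_edges n = A_edges (n - 1) \<union> {(n - 2, n)}"

definition E_edges :: "nat \<Rightarrow> (nat \<times> nat) set" where
  "E_edges n = {(1, 3), (2, 4), (3, 4)} \<union> {(i, i + 1) | i. 4 \<le> i \<and> i + 1 \<le> n}"

definition dynkin_ADE :: "('v::finite \<times> 'v) set \<Rightarrow> bool" where
  "dynkin_ADE D \<longleftrightarrow>
    (\<exists>n E (f :: nat \<Rightarrow> 'v).
      (n \<ge> 1 \<and> E = A_edges n \<or> n \<ge> 4 \<and> E = D_edges n \<or> n \<in> {6, 7, 8} \<and> E = E_edges n) \<and>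
      bij_betw f {1..n} UNIV \<and>
      D = map_prod f f ` (E \<union> E\<inverse>))"

definition orientation_of :: "('v \<times> 'v) set \<Rightarrow> ('v \<times> 'v) set \<Rightarrow> bool" where
  "orientation_of D Q \<longleftrightarrow> Q \<union> Q\<inverse> = D \<and> Q \<inter> Q\<inverse> = {}"

definition is_sink :: "('v \<times> 'v) set \<Rightarrow> 'v \<Rightarrow> bool" where
  "is_sink Q k \<longleftrightarrow> (\<forall>(a, b) \<in> Q. a = k \<or> b = k \<longrightarrow> b = k)"

definition reverse_at :: "'v \<Rightarrow> ('v \<times> 'v) set \<Rightarrow> ('v \<times> 'v) set" where
  "reverse_at k Q = {(a, b) \<in> Q. b \<noteq> k} \<union> {(k, a) | a. (a, k) \<in> Q}"

primrec adapted :: "('v \<times> 'v) set \<Rightarrow> 'v list \<Rightarrow> bool" where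
  "adapted Q [] \<longleftrightarrow> True"
| "adapted Q (i # is) \<longleftrightarrow> is_sink Q i \<and> adapted (reverse_at i Q) is"

text \<open>
  The space spanned by the weights is \<open>real ^ 'v\<close>, with the fundamental weights as standard basis.
  Hence the coordinate \<open>x $ i\<close> is the pairing of \<open>x\<close> with the simple coroot of \<open>i\<close>, and the
  coordinates of a simple root form a column of the Cartan matrix (symmetric in type \<open>ADE\<close>).
\<close>

definition fundamental_weight :: "'v::finite \<Rightarrow> real ^ 'v" where
  "fundamental_weight i = axis i 1"

definition simple_root :: "('v::finite \<times> 'v) set \<Rightarrow> 'v \<Rightarrow> real ^ 'v" where
  "simple_root D i = (\<chi> j. if j = i then 2 else if (i, j) \<in> D then - 1 else 0)"

definition simple_reflection :: "('v::finite \<times> 'v) set \<Rightarrow> 'v \<Rightarrow> real ^ 'v \<Rightarrow> real ^ 'v" where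
  "simple_reflection D i x = x - (x $ i) *\<^sub>R simple_root D i"

definition word_prod :: "('v::finite \<times> 'v) set \<Rightarrow> 'v list \<Rightarrow> real ^ 'v \<Rightarrow> real ^ 'v" where
  "word_prod D is = foldr (\<lambda>i w. simple_reflection D i \<circ> w) is id"

text \<open>Simple reflections are involutions, so the group they generate consists of their products.\<close>

definition weyl_group :: "('v::finite \<times> 'v) set \<Rightarrow> (real ^ 'v \<Rightarrow> real ^ 'v) set" where
  "weyl_group D = range (word_prod D)"

definition weyl_length :: "('v::finite \<times> 'v) set \<Rightarrow> (real ^ 'v \<Rightarrow> real ^ 'v) \<Rightarrow> nat" where
  "weyl_length D w = (LEAST l. \<exists>is. length is = l \<and> word_prod D is = w)"

definition longest_element :: "('v::finite \<times> 'v) set \<Rightarrow> (real ^ 'v \<Rightarrow> real ^ 'v) \<Rightarrow> bool" where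
  "longest_element D w \<longleftrightarrow>
    w \<in> weyl_group D \<and> (\<forall>u \<in> weyl_group D. weyl_length D u \<le> weyl_length D w)"

definition reduced_expression ::
    "('v::finite \<times> 'v) set \<Rightarrow> 'v list \<Rightarrow> (real ^ 'v \<Rightarrow> real ^ 'v) \<Rightarrow> bool" where
  "reduced_expression D is w \<longleftrightarrow> word_prod D is = w \<and> length is = weyl_length D w"

definition dual_vertex ::
    "('v::finite \<times> 'v) set \<Rightarrow> (real ^ 'v \<Rightarrow> real ^ 'v) \<Rightarrow> 'v \<Rightarrow> 'v" where
  "dual_vertex D w\<^sub>0 i = (THE j. w\<^sub>0 (simple_root D i) = - simple_root D j)"

text \<open>List positions start at 0, so \<open>level_weight D is k\<close> is the weight usually written with index \<open>k + 1\<close>.\<close>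

definition level_weight :: "('v::finite \<times> 'v) set \<Rightarrow> 'v list \<Rightarrow> nat \<Rightarrow> real ^ 'v" where
  "level_weight D is k = word_prod D (take (Suc k) is) (fundamental_weight (is ! k))"

definition level :: "('v::finite \<times> 'v) set \<Rightarrow> 'v list \<Rightarrow> 'v \<Rightarrow> (real ^ 'v) list" where
  "level D is i = map (level_weight D is) (filter (\<lambda>k. is ! k = i) [0..<length is])"

definition coxeter_element ::
    "('v::finite \<times> 'v) set \<Rightarrow> ('v \<times> 'v) set \<Rightarrow> (real ^ 'v \<Rightarrow> real ^ 'v) \<Rightarrow> bool" where
  "coxeter_element D Q c \<longleftrightarrow>
    (\<exists>bs. distinct bs \<and> set bs = UNIV \<and>
      (\<forall>j < length bs. \<forall>k < length bs. (bs ! j, bs ! k) \<in> Q \<longrightarrow> j > k) \<and>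
      c = word_prod D (rev bs))"

end

theory Submission
  imports Defs
begin

text \<open>
  If \<open>k\<close> is a sink of \<open>Q\<close>, then \<open>k\<close> may be moved to the front of the numbering that defines \<open>c\<close>,
  so the Coxeter element of \<open>S\<^sub>kQ\<close> is \<open>s\<^sub>k c s\<^sub>k\<close>. By induction along an adapted word, its
  \<open>i\<close>-th level is \<open>c\<^sup>-\<^sup>1 \<omega>\<^sub>i, c\<^sup>-\<^sup>2 \<omega>\<^sub>i, \<dots>\<close>, and the word itself maps \<open>\<omega>\<^sub>i\<close> to the last of these weights.
  It remains to see that \<open>w\<^sub>0 \<omega>\<^sub>i = -\<omega>\<^sub>i\<^sub>*\<close>. By maximality of its length, \<open>-w\<^sub>0\<close> and its
  inverse preserve the dominant cone, which is the nonnegative orthant in the basis of fundamental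
  weights; so \<open>-w\<^sub>0\<close> permutes the fundamental weights up to positive factors. These factors are \<open>1\<close>
  because \<open>w\<^sub>0\<close> respects the Cartan matrix.
\<close>

section \<open>Words in the simple reflections\<close>

lemma word_prod_Nil [simp]: "word_prod D [] = id"
  by (simp add: word_prod_def)

lemma word_prod_Cons [simp]: "word_prod D (i # is) = simple_reflection D i \<circ> word_prod D is"
  by (simp add: word_prod_def)

lemma word_prod_append [simp]: "word_prod D (is @ js) = word_prod D is \<circ> word_prod D js"
  by (induction "is") (simp_all add: comp_assoc)

lemma simple_reflection_nth:
  "simple_reflection D i x $ j = x $ j - x $ i * simple_root D i $ j"
  by (simp add: simple_reflection_def)

lemma linear_simple_reflection: "linear (simple_reflection D i)"
  by (rule linearI) (simp_all add: vec_eq_iff simple_reflection_nth algebra_simps)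

lemma linear_word_prod: "linear (word_prod D is)"
proof (induction "is")
  case Nil
  then show ?case by (simp add: linear_iff)
next
  case (Cons i "is")
  then show ?case unfolding word_prod_Cons by (rule linear_compose) (rule linear_simple_reflection)
qed

lemma simple_reflection_fundamental_weight:
  "i \<noteq> j \<Longrightarrow> simple_reflection D i (fundamental_weight j) = fundamental_weight j"
  by (simp add: vec_eq_iff simple_reflection_nth fundamental_weight_def axis_def)

lemma word_prod_fundamental_weight:
  "i \<notin> set is \<Longrightarrow> word_prod D is (fundamental_weight i) = fundamental_weight i"
  by (induction "is") (auto simp: simple_reflection_fundamental_weight)

text \<open>Every nonempty prefix of \<open>a # is\<close> begins with \<open>a\<close>, so the
  later weights are those of \<open>is\<close> moved by the reflection at \<open>a\<close>. This is
  the recursion for the induction along an adapted word.\<close>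

lemma level_Cons:
  "level D (a # is) i =
    (if a = i then [simple_reflection D a (fundamental_weight i)] else [])
      @ map (simple_reflection D a) (level D is i)"
proof -
  have upt: "[0..<length (a # is)] = 0 # map Suc [0..<length is]"
    by (simp add: upt_conv_Cons map_Suc_upt del: upt_Suc)
  show ?thesis
    unfolding level_def upt
    by (simp add: filter_map comp_def level_weight_def)
qed

lemma weyl_length_le: "weyl_length D (word_prod D is) \<le> length is"
  unfolding weyl_length_def by (rule Least_le) blast

lemma reduced_word_exists:
  obtains js where "word_prod D js = word_prod D is" "length js = weyl_length D (word_prod D is)"
proof -
  have "\<exists>js. length js = weyl_length D (word_prod D is) \<and> word_prod D js = word_prod D is"
    unfolding weyl_length_def by (rule LeastI) blast
  then show ?thesis using that by blast
qed

lemma weyl_length_reflection_le: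
  "weyl_length D (word_prod D (i # is)) \<le> Suc (weyl_length D (word_prod D is))"
proof -
  obtain js where js: "word_prod D js = word_prod D is"
    "length js = weyl_length D (word_prod D is)"
    by (rule reduced_word_exists)
  have "weyl_length D (word_prod D (i # js)) \<le> length (i # js)" by (rule weyl_length_le)
  then show ?thesis using js by simp
qed

section \<open>Linear maps preserving the nonnegative orthant\<close>

lemma fundamental_weight_expansion:
  fixes f :: "real ^ 'v::finite \<Rightarrow> 'a::real_vector"
  assumes "linear f"
  shows "f x = (\<Sum>i\<in>UNIV. x $ i *\<^sub>R f (fundamental_weight i))"
proof -
  have "x = (\<Sum>i\<in>UNIV. x $ i *\<^sub>R fundamental_weight i)"
    using basis_expansion[of x] by (simp add: fundamental_weight_def scalar_mult_eq_scaleR)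
  then have "f x = f (\<Sum>i\<in>UNIV. x $ i *\<^sub>R fundamental_weight i)" by (rule arg_cong)
  then show ?thesis by (simp only: linear_sum[OF assms] linear_scale[OF assms])
qed

text \<open>
  An automorphism of the nonnegative orthant permutes its extremal rays. Exchanging \<open>f\<close> and \<open>g\<close>
  below gives the same for \<open>f\<close>, so both are monomial maps.
\<close>

lemma orthant_automorphism_ray:
  fixes f g :: "real ^ 'v::finite \<Rightarrow> real ^ 'v"
  assumes f: "\<And>x. (\<And>k. 0 \<le> x $ k) \<Longrightarrow> (\<And>k. 0 \<le> f x $ k)"
    and g: "\<And>x. (\<And>k. 0 \<le> x $ k) \<Longrightarrow> (\<And>k. 0 \<le> g x $ k)"
    and lin: "linear g" and gf: "\<And>x. g (f x) = x" and fg: "\<And>x. f (g x) = x" and linf: "linear f"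
    and pos: "0 < f (fundamental_weight i) $ j"
  obtains a where "0 < a" "g (fundamental_weight j) = a *\<^sub>R fundamental_weight i"
proof -
  have nonneg: "0 \<le> fundamental_weight m $ k" for m k :: 'v
    by (simp add: fundamental_weight_def axis_def)
  let ?p = "\<lambda>m. f (fundamental_weight i) $ m"
  let ?y = "g (fundamental_weight j)"
  have zero: "?y $ k = 0" if "k \<noteq> i" for k
  proof -
    \<comment> \<open>For \<open>k\<close> other than \<open>i\<close>, this coordinate of
      \<open>g (f (fundamental_weight i))\<close> is zero. It is a sum of nonnegative terms, so each
      vanishes; the term at \<open>j\<close> has a positive coefficient.\<close>
    have "(\<Sum>m\<in>UNIV. ?p m * g (fundamental_weight m) $ k) = g (f (fundamental_weight i)) $ k"
      by (subst (2) fundamental_weight_expansion[OF lin]) simp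
    also have "\<dots> = 0" using that gf by (simp add: fundamental_weight_def axis_def)
    finally have "\<forall>m\<in>UNIV. ?p m * g (fundamental_weight m) $ k = 0"
      by (subst (asm) sum_nonneg_eq_0_iff) (auto intro!: mult_nonneg_nonneg f g nonneg)
    then show ?thesis using pos by force
  qed
  have eq: "?y = ?y $ i *\<^sub>R fundamental_weight i"
    using zero by (auto simp: vec_eq_iff fundamental_weight_def axis_def)
  have "?y $ i \<noteq> 0"
  proof
    assume "?y $ i = 0"
    with eq have "?y = 0" by simp
    then have "fundamental_weight j = 0" using fg[of "fundamental_weight j"] linear_0[OF linf] by simp
    then show False by (simp add: fundamental_weight_def)
  qed
  then have "0 < ?y $ i" using g[of "fundamental_weight j" i] nonneg by (simp add: less_le)
  then show ?thesis using eq that by blast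
qed

section \<open>Simply laced diagrams\<close>

locale simply_laced =
  fixes D :: "('v::finite \<times> 'v) set"
  assumes sym: "(i, j) \<in> D \<Longrightarrow> (j, i) \<in> D" and irrefl: "(i, i) \<notin> D"
begin

lemma simple_root_self: "simple_root D i $ i = 2"
  by (simp add: simple_root_def)

lemma simple_root_adjacent: "(i, j) \<in> D \<Longrightarrow> simple_root D i $ j = - 1"
  using irrefl by (auto simp: simple_root_def)

lemma simple_root_not_adjacent: "i \<noteq> j \<Longrightarrow> (i, j) \<notin> D \<Longrightarrow> simple_root D i $ j = 0"
  by (simp add: simple_root_def)

lemma simple_root_sym: "simple_root D i $ j = simple_root D j $ i"
  using sym by (auto simp: simple_root_def)

lemma simple_root_inj: "simple_root D i = simple_root D j \<Longrightarrow> i = j"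
  using simple_root_self[of i] by (auto simp: simple_root_def split: if_splits)

lemma simple_reflection_involution [simp]:
  "simple_reflection D i (simple_reflection D i x) = x"
  by (simp add: vec_eq_iff simple_reflection_nth simple_root_self algebra_simps)

lemma word_prod_rev [simp]: "word_prod D (rev is) (word_prod D is x) = x"
  by (induction "is") auto

lemma word_prod_rev' [simp]: "word_prod D is (word_prod D (rev is) x) = x"
  using word_prod_rev[of "rev is"] by simp

lemma commute:
  assumes "(i, j) \<notin> D"
  shows "simple_reflection D i (simple_reflection D j x) = simple_reflection D j (simple_reflection D i x)"
proof (cases "i = j")
  case False
  with assms show ?thesis
    using sym[of j i] simple_root_not_adjacent[of i j] simple_root_not_adjacent[of j i]
    by (auto simp: vec_eq_iff simple_reflection_nth)
qed simp

lemma braid: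
  assumes "(i, j) \<in> D"
  shows "simple_reflection D i (simple_reflection D j (simple_reflection D i x)) =
    simple_reflection D j (simple_reflection D i (simple_reflection D j x))"
  using simple_root_adjacent[OF assms] simple_root_adjacent[OF sym[OF assms]]
  by (simp add: vec_eq_iff simple_reflection_nth simple_root_self algebra_simps)

lemma word_prod_snoc_commute:
  assumes "\<And>j. j \<in> set is \<Longrightarrow> (i, j) \<notin> D"
  shows "word_prod D is (simple_reflection D i x) = simple_reflection D i (word_prod D is x)"
  using assms by (induction "is") (simp_all add: commute)

section \<open>Inverses, length and dominant weights\<close>

lemma word_prod_rev_cong:
  assumes "word_prod D is = word_prod D js"
  shows "word_prod D (rev is) = word_prod D (rev js)"
proof
  fix x
  have "word_prod D (rev is) x = word_prod D (rev is) (word_prod D js (word_prod D (rev js) x))"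
    by simp
  also have "\<dots> = word_prod D (rev js) x" by (simp add: assms[symmetric])
  finally show "word_prod D (rev is) x = word_prod D (rev js) x" .
qed

text \<open>A reversed reduced word represents the inverse, and reversing twice gives the other
  inequality. Hence the inverse of an element of maximal length has maximal length too.\<close>

lemma weyl_length_rev: "weyl_length D (word_prod D (rev is)) = weyl_length D (word_prod D is)"
proof -
  have le: "weyl_length D (word_prod D (rev ks)) \<le> weyl_length D (word_prod D ks)" for ks
  proof -
    obtain js where js: "word_prod D js = word_prod D ks"
      "length js = weyl_length D (word_prod D ks)"
      by (rule reduced_word_exists)
    have "weyl_length D (word_prod D (rev js)) \<le> length (rev js)" by (rule weyl_length_le)
    then show ?thesis using js word_prod_rev_cong[OF js(1)] by simp
  qed
  show ?thesis using le[of "is"] le[of "rev is"] by simp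
qed

text \<open>
  The statement that \<open>w\<^sup>-\<^sup>1\<close> maps the simple root of \<open>i\<close> to a positive root if \<open>\<ell>(s\<^sub>i w) > \<ell>(w)\<close>, read in
  the dual representation. The proof descends to the minimal element of the coset of \<open>w\<close> modulo the
  rank two subgroup generated by \<open>i\<close> and the first letter \<open>t\<close> of \<open>w\<close>.
\<close>

lemma word_prod_dominant_nonneg:
  assumes "weyl_length D (word_prod D is) \<le> weyl_length D (word_prod D (i # is))"
    and "\<And>k. 0 \<le> x $ k"
  shows "0 \<le> word_prod D is x $ i"
  using assms(1)
proof (induction "weyl_length D (word_prod D is)" arbitrary: "is" i rule: less_induct)
  case less
  let ?l = "\<lambda>is. weyl_length D (word_prod D is)"
  obtain js where js: "word_prod D js = word_prod D is" "length js = ?l is"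
    by (rule reduced_word_exists)
  show ?case
  proof (cases js)
    case Nil
    then show ?thesis using js assms(2) by (metis id_apply word_prod_Nil)
  next
    case (Cons t v)
    have w: "word_prod D is = word_prod D (t # v)" using js Cons by simp
    have short: "?l v < ?l is" using js(2) Cons weyl_length_le[of D v] by simp
    have tv: "?l v \<le> ?l (t # v)" using short w by simp
    have t_pos: "0 \<le> word_prod D v x $ t" using less.hyps[OF short tv] .
    have iw: "word_prod D (i # is) = word_prod D (i # t # v)" using w by simp
    have "t \<noteq> i"
    proof
      assume "t = i"
      then have "word_prod D (i # is) = word_prod D v" using iw by (simp add: fun_eq_iff)
      then show False using less.prems short by simp
    qed
    show ?thesis
    proof (cases "(t, i) \<in> D")
      case False
      \<comment> \<open>If the reflection at \<open>i\<close> shortened \<open>v\<close>, commuting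
        it past \<open>t\<close> would make \<open>i # is\<close> shorter than
        \<open>is\<close>.\<close>
      have "?l v \<le> ?l (i # v)"
      proof (rule ccontr)
        assume "\<not> ?l v \<le> ?l (i # v)"
        moreover have "?l (t # i # v) \<le> Suc (?l (i # v))" by (rule weyl_length_reflection_le)
        moreover have "word_prod D (t # i # v) = word_prod D (i # is)"
          unfolding iw by (simp add: fun_eq_iff commute[OF False])
        ultimately show False using less.prems short by simp
      qed
      then have "0 \<le> word_prod D v x $ i" using less.hyps[OF short] by blast
      then show ?thesis
        using \<open>t \<noteq> i\<close> False w
        by (simp add: simple_reflection_nth simple_root_not_adjacent)
    next
      case True
      show ?thesis
      proof (cases "?l v \<le> ?l (i # v)")
        case le: True
        have "0 \<le> word_prod D v x $ i" using less.hyps[OF short le] .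
        \<comment> \<open>Reflecting at \<open>t\<close> adds the coordinate at \<open>t\<close> to
          the one at its neighbour \<open>i\<close>; both are nonnegative.\<close>
        then show ?thesis
          using True t_pos w by (simp add: simple_reflection_nth simple_root_adjacent)
      next
        case False
        \<comment> \<open>Now \<open>is\<close> represents \<open>t # i # u\<close>, and the
          \<open>i\<close>-th coordinate of its value at \<open>x\<close> is the \<open>t\<close>-th
          coordinate for \<open>u\<close>. The braid relation supplies the length inequality for
          \<open>u\<close> and \<open>t\<close>.\<close>
        obtain u where u: "word_prod D u = word_prod D (i # v)" "length u = ?l (i # v)"
          by (rule reduced_word_exists)
        have v: "word_prod D v = word_prod D (i # u)" using u by (simp add: fun_eq_iff)
        have lu: "?l u = ?l (i # v)" using u by simp
        then have short_u: "?l u < ?l is" using False short by simp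
        have "?l u \<le> ?l (t # u)"
        proof (rule ccontr)
          assume "\<not> ?l u \<le> ?l (t # u)"
          moreover have "?l (t # i # t # u) \<le> Suc (Suc (?l (t # u)))"
            using weyl_length_reflection_le[of D t "i # t # u"]
              weyl_length_reflection_le[of D i "t # u"] by linarith
          moreover have "word_prod D (t # i # t # u) = word_prod D (i # is)"
            unfolding iw using v by (simp add: fun_eq_iff braid[OF True])
          ultimately show False using less.prems short lu False by simp
        qed
        then have "0 \<le> word_prod D u x $ t" using less.hyps[OF short_u] by blast
        then show ?thesis
          using True sym[OF True] w v
          by (simp add: simple_reflection_nth simple_root_adjacent simple_root_self)
      qed
    qed
  qed
qed

section \<open>The longest element\<close>

lemma longest_dominant_nonpos:
  assumes max: "\<And>js. weyl_length D (word_prod D js) \<le> weyl_length D (word_prod D is)"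
    and "\<And>k. 0 \<le> x $ k"
  shows "word_prod D is x $ i \<le> 0"
proof -
  \<comment> \<open>By maximality \<open>i # is\<close> is no longer than \<open>is\<close>, so the
    preceding lemma applies to \<open>i # is\<close>; the reflection at \<open>i\<close> negates the
    \<open>i\<close>-th coordinate.\<close>
  have "word_prod D (i # i # is) = word_prod D is" by (simp add: fun_eq_iff)
  then have "0 \<le> word_prod D (i # is) x $ i"
    using word_prod_dominant_nonneg[of "i # is" i x] max[of "i # is"] assms(2) by simp
  then show ?thesis by (simp add: simple_reflection_nth simple_root_self)
qed

text \<open>In matrix form, \<open>w C w\<^sup>T = C\<close> for the Cartan matrix \<open>C\<close>.\<close>

lemma word_prod_simple_root:
  "word_prod D is (simple_root D i) =
    (\<Sum>j\<in>UNIV. (word_prod D (rev is) (fundamental_weight j) $ i) *\<^sub>R simple_root D j)"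
proof (induction "is" arbitrary: i rule: rev_induct)
  case Nil
  have "(fundamental_weight j $ i) *\<^sub>R simple_root D j = (if j = i then simple_root D j else 0)" for j
    by (simp add: fundamental_weight_def axis_def)
  then show ?case by simp
next
  case (snoc k "is")
  have "word_prod D (is @ [k]) (simple_root D i) =
      word_prod D is (simple_root D i) - simple_root D i $ k *\<^sub>R word_prod D is (simple_root D k)"
    by (simp add: simple_reflection_def linear_diff linear_scale linear_word_prod)
  \<comment> \<open>The last letter \<open>k\<close> becomes the first of the reversed word; its
    effect on the coefficients agrees on both sides by symmetry of the Cartan matrix.\<close>
  also have "\<dots> = (\<Sum>j\<in>UNIV. (word_prod D (rev (is @ [k])) (fundamental_weight j) $ i) *\<^sub>R simple_root D j)"
    by (simp add: snoc.IH simple_reflection_nth simple_root_sym[of i k] scaleR_sum_right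
        sum_subtractf[symmetric] scaleR_diff_left mult.commute)
  finally show ?case .
qed

text \<open>The same \<open>j\<close> has to serve for weights and roots: the dual vertex is defined
  by roots, while the levels involve weights.\<close>

lemma longest_permutes:
  assumes max: "\<And>js. weyl_length D (word_prod D js) \<le> weyl_length D (word_prod D is)"
  obtains j where "word_prod D is (fundamental_weight i) = - fundamental_weight j"
    and "word_prod D is (simple_root D i) = - simple_root D j"
proof -
  define f where "f x = - word_prod D is x" for x
  define g where "g x = - word_prod D (rev is) x" for x
  have lin: "linear f" "linear g"
    unfolding f_def g_def by (auto intro: linear_compose_neg linear_word_prod)
  have fg: "f (g x) = x" and gf: "g (f x) = x" for x
    by (simp_all add: f_def g_def linear_neg linear_word_prod)
  have f: "0 \<le> f x $ k" if "\<And>k. 0 \<le> x $ k" for x k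
    using longest_dominant_nonpos[OF max that] by (simp add: f_def)
  have max': "weyl_length D (word_prod D js) \<le> weyl_length D (word_prod D (rev is))" for js
    using max by (simp add: weyl_length_rev)
  have g: "0 \<le> g x $ k" if "\<And>k. 0 \<le> x $ k" for x k
    using longest_dominant_nonpos[OF max' that] by (simp add: g_def)
  have nonneg: "0 \<le> fundamental_weight m $ k" for m k :: 'v
    by (simp add: fundamental_weight_def axis_def)
  have self: "fundamental_weight m $ m = 1" for m :: 'v
    by (simp add: fundamental_weight_def)
  have f0: "f (fundamental_weight i) \<noteq> 0"
  proof
    assume "f (fundamental_weight i) = 0"
    then have "fundamental_weight i = 0" using gf[of "fundamental_weight i"] linear_0[OF lin(2)] by simp
    then show False using self[of i] by simp
  qed
  then obtain j where "f (fundamental_weight i) $ j \<noteq> 0" by (auto simp: vec_eq_iff)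
  then have pos: "0 < f (fundamental_weight i) $ j"
    using f[of "fundamental_weight i" j] nonneg by (simp add: less_le)
  obtain a where a: "0 < a" "g (fundamental_weight j) = a *\<^sub>R fundamental_weight i"
    using orthant_automorphism_ray[OF f g lin(2) gf fg lin(1) pos] by blast
  have "0 < g (fundamental_weight j) $ i" using a self by simp
  then obtain b where b: "0 < b" "f (fundamental_weight i) = b *\<^sub>R fundamental_weight j"
    using orthant_automorphism_ray[OF g f lin(1) fg gf lin(2)] by blast
  have "f (g (fundamental_weight j)) = (a * b) *\<^sub>R fundamental_weight j"
    using a b by (simp add: linear_scale[OF lin(1)])
  then have "fundamental_weight j $ j = ((a * b) *\<^sub>R fundamental_weight j) $ j"
    by (simp only: fg)
  then have ab: "a * b = 1" using self by simp
  \<comment> \<open>A nonzero entry would put \<open>f (fundamental_weight i)\<close> on the rays of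
    two different fundamental weights.\<close>
  have g_off: "g (fundamental_weight m) $ i = 0" if "m \<noteq> j" for m
  proof (rule ccontr)
    assume "g (fundamental_weight m) $ i \<noteq> 0"
    then have "0 < g (fundamental_weight m) $ i"
      using g[of "fundamental_weight m" i] nonneg by (simp add: less_le)
    then obtain b' where "0 < b'" "f (fundamental_weight i) = b' *\<^sub>R fundamental_weight m"
      using orthant_automorphism_ray[OF g f lin(1) fg gf lin(2)] by blast
    with b have "(b *\<^sub>R fundamental_weight j) $ m = (b' *\<^sub>R fundamental_weight m) $ m" by simp
    with \<open>0 < b'\<close> that show False by (simp add: fundamental_weight_def axis_def)
  qed
  have f_off: "f (fundamental_weight m) $ j = 0" if "m \<noteq> i" for m
  proof (rule ccontr)
    assume "f (fundamental_weight m) $ j \<noteq> 0"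
    then have "0 < f (fundamental_weight m) $ j"
      using f[of "fundamental_weight m" j] nonneg by (simp add: less_le)
    then obtain a' where "0 < a'" "g (fundamental_weight j) = a' *\<^sub>R fundamental_weight m"
      using orthant_automorphism_ray[OF f g lin(2) gf fg lin(1)] by blast
    with a have "(a *\<^sub>R fundamental_weight i) $ m = (a' *\<^sub>R fundamental_weight m) $ m" by simp
    with \<open>0 < a'\<close> that show False by (simp add: fundamental_weight_def axis_def)
  qed
  have root: "f (simple_root D i) = a *\<^sub>R simple_root D j"
  proof -
    have "f (simple_root D i) = (\<Sum>m\<in>UNIV. (g (fundamental_weight m) $ i) *\<^sub>R simple_root D m)"
      unfolding f_def g_def word_prod_simple_root[of "is" i] by (simp add: sum_negf)
    also have "\<dots> = (\<Sum>m\<in>{j}. (g (fundamental_weight m) $ i) *\<^sub>R simple_root D m)"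
      by (rule sum.mono_neutral_right) (auto simp: g_off)
    finally show ?thesis using a self by simp
  qed
  \<comment> \<open>The \<open>j\<close>-th coordinate is \<open>2 * a\<close> by
    \<open>root\<close> and \<open>2 * b\<close> by expansion in the fundamental weights. With
    \<open>a * b = 1\<close> and positivity, both factors are 1.\<close>
  have "f (simple_root D i) $ j = (\<Sum>m\<in>UNIV. simple_root D i $ m * f (fundamental_weight m) $ j)"
    by (subst fundamental_weight_expansion[OF lin(1)]) simp
  also have "\<dots> = (\<Sum>m\<in>{i}. simple_root D i $ m * f (fundamental_weight m) $ j)"
    by (rule sum.mono_neutral_right) (auto simp: f_off)
  also have "\<dots> = 2 * b" using b self by (simp add: simple_root_self)
  finally have "a = b" using root by (simp add: simple_root_self)
  with ab a have "a = 1" by (simp add: power2_eq_1_iff flip: power2_eq_square)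
  show ?thesis
  proof (rule that)
    show "word_prod D is (fundamental_weight i) = - fundamental_weight j"
      using arg_cong[OF b(2), of uminus] \<open>a = b\<close> \<open>a = 1\<close> by (simp add: f_def)
    show "word_prod D is (simple_root D i) = - simple_root D j"
      using arg_cong[OF root, of uminus] \<open>a = 1\<close> by (simp add: f_def)
  qed
qed

lemma longest_dual_vertex:
  assumes "longest_element D w"
  shows "w (fundamental_weight i) = - fundamental_weight (dual_vertex D w i)"
proof -
  obtain "is" where w: "w = word_prod D is"
    using assms by (auto simp: longest_element_def weyl_group_def)
  have "weyl_length D (word_prod D js) \<le> weyl_length D (word_prod D is)" for js
    using assms unfolding longest_element_def weyl_group_def w by blast
  then obtain j where j: "w (fundamental_weight i) = - fundamental_weight j"
    "w (simple_root D i) = - simple_root D j"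
    using longest_permutes[of "is" i] unfolding w by blast
  have "dual_vertex D w i = j"
    unfolding dual_vertex_def using j(2) simple_root_inj by (intro the_equality) auto
  then show ?thesis using j(1) by simp
qed

section \<open>Adapted words\<close>

lemma orientation_reverse_at:
  assumes "orientation_of D Q" "is_sink Q i"
  shows "orientation_of D (reverse_at i Q)"
proof -
  have "reverse_at i Q \<union> (reverse_at i Q)\<inverse> = Q \<union> Q\<inverse>"
    by (auto simp: reverse_at_def)
  moreover have "reverse_at i Q \<inter> (reverse_at i Q)\<inverse> = {}"
    using assms by (auto simp: reverse_at_def orientation_of_def is_sink_def)
  ultimately show ?thesis using assms(1) by (simp add: orientation_of_def)
qed

text \<open>Arrows run from later to earlier entries of \<open>bs\<close>, so
  \<open>word_prod D bs\<close> is the inverse of the Coxeter element. \<open>Q\<close> and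
  \<open>bs\<close> vary in the induction, as each letter changes both.\<close>

lemma adapted_level:
  assumes "orientation_of D Q" "adapted Q ws"
    and "distinct bs" "set bs = UNIV" "sorted_wrt (\<lambda>a b. (a, b) \<notin> Q) bs"
  shows "level D ws i =
      map (\<lambda>m. (word_prod D bs ^^ Suc m) (fundamental_weight i)) [0..<count_list ws i]
    \<and> word_prod D ws (fundamental_weight i) =
      (word_prod D bs ^^ count_list ws i) (fundamental_weight i)"
  using assms
proof (induction ws arbitrary: Q bs)
  case Nil
  then show ?case by (simp add: level_def)
next
  case (Cons k ws)
  let ?Q = "reverse_at k Q"
  have sink: "is_sink Q k" and ad: "adapted ?Q ws" using Cons.prems by auto
  obtain xs ys where bs: "bs = xs @ k # ys"
    using Cons.prems(4) by (metis UNIV_I split_list)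
  \<comment> \<open>Reversal turns the sink \<open>k\<close> into a source, which belongs at the end
    of the numbering.\<close>
  let ?bs = "xs @ ys @ [k]"
  define s where "s = simple_reflection D k"
  define d where "d = word_prod D bs"
  define e where "e = word_prod D ?bs"
  have loop: "(a, a) \<notin> Q" for a using Cons.prems(1) by (auto simp: orientation_of_def)
  have k: "k \<notin> set xs" "k \<notin> set ys" using Cons.prems(3) bs by auto
  have sorted: "sorted_wrt (\<lambda>a b. (a, b) \<notin> ?Q) ?bs"
  proof -
    have "(a, b) \<notin> ?Q" if "(a, b) \<notin> Q" "a \<noteq> k" for a b
      using that by (auto simp: reverse_at_def)
    moreover have "(a, k) \<notin> ?Q" for a
      using loop by (auto simp: reverse_at_def)
    moreover have "sorted_wrt (\<lambda>a b. (a, b) \<notin> Q) (xs @ ys)"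
      using Cons.prems(5) by (simp add: bs sorted_wrt_append)
    then have "sorted_wrt (\<lambda>a b. (a, b) \<notin> ?Q) (xs @ ys)"
      by (rule sorted_wrt_mono_rel[rotated]) (use k calculation in auto)
    ultimately show ?thesis by (auto simp: sorted_wrt_append)
  qed
  have "distinct ?bs" "set ?bs = UNIV" using Cons.prems(3,4) bs by auto
  note IH = Cons.IH[OF orientation_reverse_at[OF Cons.prems(1) sink] ad this sorted, folded e_def]
  \<comment> \<open>The numbering excludes an arrow from \<open>x\<close> to \<open>k\<close>, the
    sink one from \<open>k\<close> to \<open>x\<close>. So the reflection at \<open>k\<close>
    commutes past \<open>xs\<close> to the front.\<close>
  have "(k, x) \<notin> D" if "x \<in> set xs" for x
  proof -
    have "(x, k) \<notin> Q" using Cons.prems(5) that by (auto simp: bs sorted_wrt_append)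
    moreover have "(k, x) \<notin> Q" using sink that k by (auto simp: is_sink_def)
    ultimately show ?thesis using Cons.prems(1) by (auto simp: orientation_of_def)
  qed
  then have d: "d x = s (word_prod D (xs @ ys) x)" for x
    by (simp add: d_def bs s_def word_prod_snoc_commute)
  have conj: "s (e x) = d (s x)" for x
    by (simp add: d e_def s_def)
  have conj_pow: "s ((e ^^ m) x) = (d ^^ m) (s x)" for m x
    by (induction m) (simp_all add: conj)
  have "d (fundamental_weight k) = s (fundamental_weight k)"
    using k by (simp only: d word_prod_fundamental_weight set_append Un_iff simp_thms)
  \<comment> \<open>So \<open>s\<close> raises the exponent by one exactly when
    \<open>k = i\<close>, which makes room for the new first weight.\<close>
  then have first: "s (fundamental_weight i) = (if k = i then d (fundamental_weight i) else fundamental_weight i)"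
    by (auto simp: s_def simple_reflection_fundamental_weight)
  have upt: "[0..<Suc n] = 0 # map Suc [0..<n]" for n
    by (simp add: upt_conv_Cons map_Suc_upt del: upt_Suc)
  have shift: "(d ^^ m) (d x) = d ((d ^^ m) x)" for m x
    by (simp add: funpow_swap1)
  show ?case
    unfolding d_def[symmetric] level_Cons s_def[symmetric]
    using IH by (simp add: upt first conj conj_pow shift s_def[symmetric] comp_def del: upt_Suc)
qed

end

section \<open>Levels as powers of the Coxeter element\<close>

lemma orientation_simply_laced: "orientation_of D Q \<Longrightarrow> simply_laced D"
  by unfold_locales (auto simp: orientation_of_def)

theorem proposition2p7:
  fixes D Q :: "('v::finite \<times> 'v) set"
    and w\<^sub>0 c :: "real ^ 'v \<Rightarrow> real ^ 'v"
    and ws :: "'v list"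
    and i :: 'v
  assumes "dynkin_ADE D"
    and "orientation_of D Q"
    and "longest_element D w\<^sub>0"
    and "reduced_expression D ws w\<^sub>0"
    and "adapted Q ws"
    and "coxeter_element D Q c"
  shows "level D ws i =
    map (\<lambda>m. (c ^^ m) (- fundamental_weight (dual_vertex D w\<^sub>0 i))) (rev [0..<count_list ws i])"
proof -
  interpret simply_laced D using assms(2) by (rule orientation_simply_laced)
  obtain bs where bs: "distinct bs" "set bs = UNIV" "c = word_prod D (rev bs)"
    and order: "\<forall>j < length bs. \<forall>k < length bs. (bs ! j, bs ! k) \<in> Q \<longrightarrow> j > k"
    using assms(6) by (auto simp: coxeter_element_def)
  have "sorted_wrt (\<lambda>a b. (a, b) \<notin> Q) bs"
    unfolding sorted_wrt_iff_nth_less using order by (meson less_trans not_less_iff_gr_or_eq)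
  note level = adapted_level[OF assms(2,5) bs(1,2) this, of i]
  let ?d = "word_prod D bs" and ?N = "count_list ws i" and ?w = "fundamental_weight i"
  have last: "- fundamental_weight (dual_vertex D w\<^sub>0 i) = (?d ^^ ?N) ?w"
    using level longest_dual_vertex[OF assms(3), of i] assms(4)
    by (simp add: reduced_expression_def)
  have cancel: "(c ^^ m) ((?d ^^ (m + n)) x) = (?d ^^ n) x" for m n x
  proof (induction m)
    case (Suc m)
    have "(c ^^ Suc m) ((?d ^^ (Suc m + n)) x) = (c ^^ m) (c (?d ((?d ^^ (m + n)) x)))"
      by (simp add: funpow_swap1[of c])
    also have "\<dots> = (?d ^^ n) x" by (simp only: bs(3) word_prod_rev Suc[unfolded bs(3)])
    finally show ?case .
  qed simp
  \<comment> \<open>Position \<open>m\<close>, counted from 0, carries the exponent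
    \<open>Suc m\<close> of the inverse of \<open>c\<close>; read back from the last weight, this is
    the power \<open>?N - Suc m\<close> of \<open>c\<close>.\<close>
  have "(c ^^ (?N - Suc m)) ((?d ^^ ?N) ?w) = (?d ^^ Suc m) ?w" if "m < ?N" for m
    using cancel[of "?N - Suc m" "Suc m" ?w] that by simp
  then show ?thesis
    unfolding last conjunct1[OF level] by (intro nth_equalityI) (simp_all add: rev_nth del: funpow.simps)
qed

end
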